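(* Let $N \geq 4$. The following is a complete ordering of the set $\mathcal{T}_{N,N-2}$ of all trees (up to isomorphism) with $N$ nodes and diameter $N-2$: every tree in $\mathcal{T}_{N,N-2}$ is one of the trees $P_{N,N-2,i}$ with $1 \leq i \leq \lfloor\frac{N-2}{2}\rfloor$, each of these trees lies in $\mathcal{T}_{N,N-2}$, and $$\mathcal{H}_2\left(P_{N,N-2,\lfloor\frac{N-2}{2}\rfloor}\right) < \mathcal{H}_2\left(P_{N,N-2,\lfloor\frac{N-2}{2}\rfloor-1}\right) < \cdots < \mathcal{H}_2\left(P_{N,N-2,1}\right).$$
   Context: All trees are finite, undirected, with unit weight on every edge; equality of trees means graph isomorphism. The distance between two nodes is the number of edges on the path joining them, and the diameter of a tree is the maximum distance between two of its nodes. $\mathcal{T}_{N,d}$ is the set of all trees with $N$ nodes and diameter $d$. $\mathcal{H}_2$ norm: for a connected undirected graph on $N$ nodes with Laplacian $L = D - A$ ($A$ the adjacency matrix, $D$ the diagonal matrix of degrees), let $0=\lambda_1 < \lambda_2 \leq \dots \leq \lambda_N$ be the eigenvalues of $L$. The $\mathcal{H}_2$ norm of the graph is $\mathcal{H}_2 = \left(\sum_{i=2}^{N}\frac{1}{2\lambda_i}\right)^{1/2}$. (This is the $\mathcal{H}_2$ norm of the system $\dot y = -QLQ^T y + Q\xi$ with output $z=y$, where the rows of $Q\in\mathbb{R}^{(N-1)\times N}$ form an orthonormal basis of the orthogonal complement of the all-ones vector.) The tree $P_{N,d,i}$ (for $2 \leq d \leq N-2$ and $1 \leq i \leq \lfloor\frac{d}{2}\rfloor$):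 take a path of length $d$ (with $d+1$ nodes), number its internal nodes consecutively $1,\dots,d-1$ along the path, and attach $N-d-1$ additional leaf nodes to the $i$-th internal node. *)

theory Defs
  imports
    "Graph_Theory.Pair_Digraph"
    "Graph_Theory.Digraph_Component"
    "Graph_Theory.Digraph_Isomorphism"
    "Jordan_Normal_Form.Char_Poly"
begin

text \<open>
  Finite simple undirected graphs are modelled by the locale \<open>pair_graph\<close>: finite, loop-free,
  symmetric digraphs whose arcs are pairs of vertices. An undirected edge is a pair of opposite
  arcs, and graph isomorphism is \<open>digraph_iso\<close>.
\<close>

text \<open>
  The constant \<open>Digraph_Component.tree\<close> cannot be used for symmetric digraphs, since there the
  walk along an arc and back counts as a cycle. Excluding closed walks of length 2 leaves
  exactly the cycles of the undirected graph.
\<close>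

definition undirected_tree :: "'a pair_pre_digraph \<Rightarrow> bool" where
  "undirected_tree G \<longleftrightarrow>
     pair_graph G \<and> Digraph_Component.connected (with_proj G) \<and>
     \<not> (\<exists>p. pre_digraph.cycle (with_proj G) p \<and> 3 \<le> length p)"

text \<open>Only meaningful on trees, where the path joining two vertices exists and is unique.\<close>

definition tree_dist :: "'a pair_pre_digraph \<Rightarrow> 'a \<Rightarrow> 'a \<Rightarrow> nat" where
  "tree_dist G u v = length (THE p. pre_digraph.apath (with_proj G) u p v)"

definition tree_diameter :: "'a pair_pre_digraph \<Rightarrow> nat" where
  "tree_diameter G = Max {tree_dist G u v | u v. u \<in> pverts G \<and> v \<in> pverts G}"

definition trees :: "nat \<Rightarrow> nat \<Rightarrow> 'a pair_pre_digraph set" where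
  "trees N d = {G. undirected_tree G \<and> card (pverts G) = N \<and> tree_diameter G = d}"

text \<open>
  Rows and columns of the matrices follow the increasing enumeration of the vertices; the
  spectrum of the Laplacian does not depend on this choice.
\<close>

definition vertex_list :: "'a::linorder pair_pre_digraph \<Rightarrow> 'a list" where
  "vertex_list G = sorted_list_of_set (pverts G)"

definition adjacency_mat :: "'a::linorder pair_pre_digraph \<Rightarrow> real mat" where
  "adjacency_mat G = mat (card (pverts G)) (card (pverts G))
     (\<lambda>(i, j). if (vertex_list G ! i, vertex_list G ! j) \<in> parcs G then 1 else 0)"

definition degree_mat :: "'a::linorder pair_pre_digraph \<Rightarrow> real mat" where
  "degree_mat G = mat (card (pverts G)) (card (pverts G))
     (\<lambda>(i, j). if i = j then real (out_degree (with_proj G) (vertex_list G ! i)) else 0)"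

definition laplacian :: "'a::linorder pair_pre_digraph \<Rightarrow> real mat" where
  "laplacian G = degree_mat G - adjacency_mat G"

text \<open>
  All eigenvalues in increasing order, repeated by algebraic multiplicity. A Laplacian is a real
  symmetric matrix, so all roots of its characteristic polynomial are real and none is missing.
\<close>

definition laplacian_eigenvalues :: "'a::linorder pair_pre_digraph \<Rightarrow> real list" where
  "laplacian_eigenvalues G = sorted_list_of_multiset (proots (char_poly (laplacian G)))"

text \<open>List positions start at 0, so \<open>\<lambda>\<^sub>i\<close> is the entry at position \<open>i - 1\<close>.\<close>

definition H2_norm :: "'a::linorder pair_pre_digraph \<Rightarrow> real" where
  "H2_norm G = sqrt (\<Sum>i = 2..card (pverts G). 1 / (2 * (laplacian_eigenvalues G ! (i - 1))))"

text \<open>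
  The path is \<open>0, 1, \<dots>, d\<close>, so that its \<open>i\<close>-th internal node is the number \<open>i\<close>. The
  \<open>N - d - 1\<close> additional leaves are \<open>d + 1, \<dots>, N - 1\<close>.
\<close>

definition P_tree :: "nat \<Rightarrow> nat \<Rightarrow> nat \<Rightarrow> nat pair_pre_digraph" where
  "P_tree N d i =
     (let E = {(k, Suc k) | k. k < d} \<union> {(i, l) | l. d < l \<and> l < N}
      in \<lparr>pverts = {0..<N}, parcs = E \<union> E\<inverse>\<rparr>)"

end

theory Submission
  imports Defs
begin

text \<open>
  The squared \<open>H2\<close> norm of a tree is the sum of the distances of all ordered pairs of vertices
  divided by four times the number of vertices (\<open>H2_norm_tree\<close>). Comparing norms is thus
  comparing Wiener indices, and moving the single extra leaf of \<open>P_tree (d + 2) d i\<close> towards the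
  middle of the path decreases only the sum of the distances of the leaf (\<open>H2_norm_P_tree_decreasing\<close>).

  The formula for the norm rests on one combinatorial fact: for a vertex \<open>v\<close> of a tree, every other
  vertex has exactly one neighbour nearer to \<open>v\<close>, and its other neighbours are farther away
  (\<open>unique_nearer_neighbour\<close>). Hence the distance matrix \<open>D\<close> and the Laplacian \<open>L\<close> satisfy
  \<open>D L = -2 I + \<one> \<tau>\<^sup>T\<close>, which says that \<open>- D / 2\<close> is an inverse of \<open>L\<close> modulo the all-ones
  vector. The sum of the inverses of the nonzero eigenvalues is the trace of that inverse on the
  quotient by the all-ones vector (\<open>laplacian_spectrum_trace\<close>): both are the negative ratio of the
  coefficients of degree 2 and 1 of the characteristic polynomial, computed once from its linear
  factors and once from its minors. That the polynomial splits over the reals, with nonnegative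
  roots, comes from the Dirichlet form.

  For the classification, paths in a tree are unique (\<open>apath_unique\<close>). A tree with \<open>d + 2\<close> vertices
  and diameter \<open>d\<close> consists of a longest path and one more vertex, which can only be a leaf at
  an internal vertex of the path; up to reflection the internal vertex is in the first half
  (\<open>iso_P_tree_if_card_eq_diameter_plus_2\<close>).
\<close>

section \<open>Inverse eigenvalues of Laplacian matrices\<close>

text \<open>
For a matrix with zero row sums this is the action on the quotient by the all-ones vector, in the
basis given by the unit vectors other than the first one; its spectrum is that of the matrix with
one zero removed.
\<close>

definition deflate :: "'a::comm_ring_1 mat \<Rightarrow> 'a mat" where
  "deflate A = mat (dim_row A - 1) (dim_col A - 1)
     (\<lambda>(i, j). A $$ (Suc i, Suc j) - A $$ (0, Suc j))"

lemma deflate_carrier [simp]: "A \<in> carrier_mat (Suc n) (Suc n) \<Longrightarrow> deflate A \<in> carrier_mat n n"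
  by (auto simp: deflate_def)

lemma index_mult_mat_sum:
  assumes "A \<in> carrier_mat n m" "B \<in> carrier_mat m k" "i < n" "j < k"
  shows "(A * B) $$ (i, j) = (\<Sum>l<m. A $$ (i, l) * B $$ (l, j))"
  using assms by (auto simp: scalar_prod_def lessThan_atLeast0 intro!: sum.cong)

text \<open>
In the basis that replaces the first unit vector by the all-ones vector, the first column vanishes
and the lower right block is the deflated matrix.
\<close>

lemma char_poly_zero_row_sums:
  fixes A :: "'a::field mat"
  assumes A: "A \<in> carrier_mat (Suc n) (Suc n)"
    and row_sum: "\<And>i. i < Suc n \<Longrightarrow> (\<Sum>j<Suc n. A $$ (i, j)) = 0"
  shows "char_poly A = [:0, 1:] * char_poly (deflate A)"
proof -
  define P :: "'a mat" where
    "P = mat (Suc n) (Suc n) (\<lambda>(i, j). if i = j \<or> j = 0 then 1 else 0)"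
  define Q :: "'a mat" where
    "Q = mat (Suc n) (Suc n) (\<lambda>(i, j). if i = j then 1 else if j = 0 then -1 else 0)"
  define R where "R = mat 1 n (\<lambda>(i, j). A $$ (0, Suc j))"
  define B where "B = four_block_mat (0\<^sub>m 1 1) R (0\<^sub>m n 1) (deflate A)"
  have R: "R \<in> carrier_mat 1 n" and D: "deflate A \<in> carrier_mat n n"
    using A by (auto simp: R_def)
  have carr: "P \<in> carrier_mat (Suc n) (Suc n)" "Q \<in> carrier_mat (Suc n) (Suc n)"
    by (auto simp: P_def Q_def)
  have B: "B \<in> carrier_mat (Suc n) (Suc n)"
    unfolding B_def using four_block_carrier_mat[OF zero_carrier_mat[of 1 1] D] by simp
  have B_index: "B $$ (i, j) = (if j = 0 then 0 else if i = 0 then A $$ (0, j)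
      else A $$ (i, j) - A $$ (0, j))" if "i < Suc n" "j < Suc n" for i j
    using that A R D by (cases i; cases j) (auto simp: B_def R_def deflate_def)
  have shift: "(\<Sum>l<Suc n. f l) = f 0 + (\<Sum>l<n. f (Suc l))" for f :: "nat \<Rightarrow> 'a"
    by (rule sum.lessThan_Suc_shift)
  have PQ: "P * Q = 1\<^sub>m (Suc n)"
  proof (rule eq_matI)
    fix i j assume ij: "i < dim_row (1\<^sub>m (Suc n) :: 'a mat)" "j < dim_col (1\<^sub>m (Suc n) :: 'a mat)"
    have "(P * Q) $$ (i, j) = (\<Sum>l<Suc n. P $$ (i, l) * Q $$ (l, j))"
      by (rule index_mult_mat_sum[OF carr]) (use ij in auto)
    also have "\<dots> = (1\<^sub>m (Suc n)) $$ (i, j)"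
      using ij unfolding shift
      by (cases i; cases j)
        (auto simp: P_def Q_def if_distrib[where f = "\<lambda>x. _ * x"] if_distrib[where f = "\<lambda>x. x * _"]
          sum_negf sum.delta sum.delta' cong: if_cong)
    finally show "(P * Q) $$ (i, j) = (1\<^sub>m (Suc n)) $$ (i, j)" .
  qed (use carr in auto)
  have QP: "Q * P = 1\<^sub>m (Suc n)"
    by (rule mat_mult_left_right_inverse[OF carr PQ])
  have "A * P = P * B"
  proof (rule eq_matI)
    fix i j assume "i < dim_row (P * B)" "j < dim_col (P * B)"
    then have ij: "i < Suc n" "j < Suc n" using carr B by auto
    have "(A * P) $$ (i, j) = (\<Sum>l<Suc n. A $$ (i, l) * P $$ (l, j))"
      by (rule index_mult_mat_sum[OF A carr(1) ij])
    also have "\<dots> = (if j = 0 then 0 else A $$ (i, j))"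
    proof (cases "j = 0")
      case True
      then have "(\<Sum>l<Suc n. A $$ (i, l) * P $$ (l, j)) = (\<Sum>l<Suc n. A $$ (i, l))"
        by (intro sum.cong) (auto simp: P_def)
      then show ?thesis using True row_sum[OF ij(1)] by simp
    next
      case False
      then have "(\<Sum>l<Suc n. A $$ (i, l) * P $$ (l, j)) = (\<Sum>l<Suc n. if l = j then A $$ (i, l) else 0)"
        using ij by (intro sum.cong) (auto simp: P_def)
      then show ?thesis using False ij by (simp add: sum.delta)
    qed
    also have "\<dots> = (\<Sum>l<Suc n. P $$ (i, l) * B $$ (l, j))"
    proof -
      have "(\<Sum>l<Suc n. P $$ (i, l) * B $$ (l, j)) = B $$ (0, j) + (\<Sum>l<n. if Suc l = i then B $$ (i, j) else 0)"
        using ij unfolding shift by (auto simp: P_def intro!: sum.cong)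
      also have "\<dots> = (if j = 0 then 0 else A $$ (i, j))"
        using ij by (cases i) (auto simp: B_index sum.delta)
      finally show ?thesis by simp
    qed
    also have "\<dots> = (P * B) $$ (i, j)"
      by (rule index_mult_mat_sum[OF carr(1) B ij, symmetric])
    finally show "(A * P) $$ (i, j) = (P * B) $$ (i, j)" .
  qed (use carr A B in auto)
  then have "A = P * B * Q"
    using A carr PQ by (metis assoc_mult_mat right_mult_one_mat)
  then have "similar_mat_wit A B P Q"
    using A B carr PQ QP by (intro similar_mat_witI[of _ _ "Suc n"])
  then have "similar_mat A B"
    unfolding similar_mat_def by blast
  then have "char_poly A = char_poly B"
    by (rule char_poly_similar)
  also have "\<dots> = char_poly (0\<^sub>m 1 1 :: 'a mat) * char_poly (deflate A)"
    unfolding B_def by (rule char_poly_four_block_zeros_col[OF _ R D]) simp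
  also have "char_poly (0\<^sub>m 1 1 :: 'a mat) = [:0, 1:]"
    by (subst char_poly_upper_triangular[of _ 1]) (auto simp: diag_mat_def)
  finally show ?thesis .
qed

text \<open>
A right factor only needs to be known up to multiples of the all-ones vector in each column, since
the left factor annihilates them; subtracting the first row of the right factor is such a change.
\<close>

lemma deflate_mult:
  fixes M L :: "'a::comm_ring_1 mat"
  assumes M: "M \<in> carrier_mat (Suc n) (Suc n)" and L: "L \<in> carrier_mat (Suc n) (Suc n)"
    and row_sum: "\<And>i. i < Suc n \<Longrightarrow> (\<Sum>j<Suc n. M $$ (i, j)) = 0"
  shows "deflate M * deflate L = deflate (M * L)"
proof (rule eq_matI)
  fix i j assume "i < dim_row (deflate (M * L))" "j < dim_col (deflate (M * L))"
  then have ij: "i < n" "j < n" using M L by (auto simp: deflate_def)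
  have "(deflate M * deflate L) $$ (i, j)
      = (\<Sum>k<n. (M $$ (Suc i, Suc k) - M $$ (0, Suc k)) * (L $$ (Suc k, Suc j) - L $$ (0, Suc j)))"
    using ij M L by (subst index_mult_mat_sum[of _ n n _ n]) (auto simp: deflate_def)
  also have "\<dots> = (\<Sum>k<Suc n. (M $$ (Suc i, k) - M $$ (0, k)) * (L $$ (k, Suc j) - L $$ (0, Suc j)))"
    unfolding sum.lessThan_Suc_shift by simp
  also have "\<dots> = (\<Sum>k<Suc n. M $$ (Suc i, k) * L $$ (k, Suc j)) - (\<Sum>k<Suc n. M $$ (0, k) * L $$ (k, Suc j))
      - ((\<Sum>k<Suc n. M $$ (Suc i, k)) - (\<Sum>k<Suc n. M $$ (0, k))) * L $$ (0, Suc j)"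
    by (simp only: algebra_simps sum.distrib sum_subtractf sum_distrib_left)
  also have "\<dots> = (M * L) $$ (Suc i, Suc j) - (M * L) $$ (0, Suc j)"
    using ij by (simp only: row_sum index_mult_mat_sum[OF M L] Suc_less_eq zero_less_Suc) simp
  also have "\<dots> = deflate (M * L) $$ (i, j)"
    using ij M L by (simp add: deflate_def)
  finally show "(deflate M * deflate L) $$ (i, j) = deflate (M * L) $$ (i, j)" .
qed (use M L in \<open>auto simp: deflate_def\<close>)

text \<open>
The derivative of the characteristic polynomial is the sum of those of the principal minors, and
at 0 these are, up to a common sign, the diagonal entries of the adjugate \<open>det A \<cdot> B\<close>.
The logarithmic derivative at 0 thus turns the sum of the inverse eigenvalues into a trace.
\<close>

lemma pderiv_char_poly_0_left_inverse:
  fixes A :: "'a::field mat"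
  assumes A: "A \<in> carrier_mat n n" and B: "B \<in> carrier_mat n n" and BA: "B * A = 1\<^sub>m n"
  shows "poly (pderiv (char_poly A)) 0 = - poly (char_poly A) 0 * (\<Sum>i<n. B $$ (i, i))"
    and "poly (char_poly A) 0 \<noteq> 0"
proof -
  have at_0: "poly (char_poly C) 0 = (-1) ^ m * det C" if "C \<in> carrier_mat m m" for C :: "'a mat" and m
  proof -
    have "- char_matrix C 0 = (-1) \<cdot>\<^sub>m C"
      using that by (intro eq_matI) (auto simp: char_matrix_def)
    then show ?thesis
      using char_poly_matrix[OF that, of 0] that by (simp add: det_smult)
  qed
  have minor: "det (mat_delete A i i) = det A * B $$ (i, i)" if i: "i < n" for i
  proof -
    have "B * (A * adj_mat A) = B * A * adj_mat A"
      using assoc_mult_mat[OF B A adj_mat(1)[OF A]] by simp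
    also have "\<dots> = adj_mat A" using adj_mat(1)[OF A] by (simp add: BA)
    also have "B * (A * adj_mat A) = det A \<cdot>\<^sub>m B"
      using B by (simp add: adj_mat(2)[OF A] mult_smult_distrib[of _ n n _ n])
    finally have "adj_mat A $$ (i, i) = (det A \<cdot>\<^sub>m B) $$ (i, i)" by simp
    then show ?thesis using A B i by (simp add: adj_mat_def cofactor_def)
  qed
  have "det B * det A = 1"
    using det_mult[OF B A] BA by simp
  then show "poly (char_poly A) 0 \<noteq> 0"
    unfolding at_0[OF A] by auto
  have "poly (pderiv (char_poly A)) 0 = (\<Sum>i<n. poly (char_poly (mat_delete A i i)) 0)"
    by (simp add: pderiv_char_poly[OF A] poly_sum)
  also have "\<dots> = (\<Sum>i<n. (-1) ^ (n - 1) * det A * B $$ (i, i))"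
    using at_0[OF mat_delete_carrier[OF A]] by (intro sum.cong) (auto simp: minor)
  also have "\<dots> = (-1) ^ (n - 1) * det A * (\<Sum>i<n. B $$ (i, i))"
    by (rule sum_distrib_left[symmetric])
  also have "\<dots> = - poly (char_poly A) 0 * (\<Sum>i<n. B $$ (i, i))"
    by (cases n) (simp_all add: at_0[OF A] del: sum.lessThan_Suc)
  finally show "poly (pderiv (char_poly A)) 0 = - poly (char_poly A) 0 * (\<Sum>i<n. B $$ (i, i))" .
qed

lemma sum_list_inverse_roots:
  fixes rs :: "'a::field list"
  assumes "0 \<notin> set rs"
  defines "q \<equiv> \<Prod>r\<leftarrow>rs. [:- r, 1:]"
  shows "poly (pderiv q) 0 = - poly q 0 * (\<Sum>r\<leftarrow>rs. 1 / r)"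
  using assms(1) unfolding q_def
  by (induction rs) (auto simp: pderiv_mult pderiv_pCons field_simps simp del: mult_pCons_left)

lemma proots_linear_factors:
  fixes rs :: "'a::idom list"
  shows "proots (\<Prod>r\<leftarrow>rs. [:- r, 1:]) = mset rs"
proof (induction rs)
  case (Cons r rs)
  have "(\<Prod>r\<leftarrow>rs. [:- r, 1:]) \<noteq> 0"
    by (auto simp: prod_list_zero_iff)
  then show ?case using Cons by (simp add: proots_mult del: mult_pCons_left)
qed auto

text \<open>
Pairing the eigenvalue equation with the conjugate of the eigenvector gives
\<open>2 \<mu> \<Sum>\<^sub>i \<bar>v\<^sub>i\<bar>\<^sup>2 = \<Sum>\<^sub>i\<^sub>,\<^sub>j a\<^sub>i\<^sub>j \<bar>v\<^sub>i - v\<^sub>j\<bar>\<^sup>2\<close>, so \<open>\<mu>\<close> is real and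
nonnegative at once.
\<close>

lemma real_nonneg_of_laplacian_equation:
  fixes a :: "nat \<Rightarrow> nat \<Rightarrow> real" and v :: "nat \<Rightarrow> complex" and \<mu> :: complex
  assumes sym: "\<And>i j. i < n \<Longrightarrow> j < n \<Longrightarrow> a i j = a j i"
    and nonneg: "\<And>i j. i < n \<Longrightarrow> j < n \<Longrightarrow> 0 \<le> a i j"
    and eq: "\<And>i. i < n \<Longrightarrow> (\<Sum>j<n. of_real (a i j) * (v i - v j)) = \<mu> * v i"
    and nonzero: "k < n" "v k \<noteq> 0"
  shows "\<exists>r\<ge>0. \<mu> = of_real r"
proof -
  define S where "S = (\<Sum>i<n. \<Sum>j<n. of_real (a i j) * (cnj (v i) * (v i - v j)))"
  define E where "E = (\<Sum>i<n. \<Sum>j<n. a i j * (cmod (v i - v j))\<^sup>2)"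
  define V where "V = (\<Sum>i<n. (cmod (v i))\<^sup>2)"
  have "S = (\<Sum>i<n. cnj (v i) * (\<Sum>j<n. of_real (a i j) * (v i - v j)))"
    unfolding S_def sum_distrib_left by (intro sum.cong refl) (simp add: algebra_simps)
  also have "\<dots> = (\<Sum>i<n. \<mu> * of_real ((cmod (v i))\<^sup>2))"
    by (intro sum.cong refl) (simp add: eq complex_norm_square mult_ac del: of_real_power)
  also have "\<dots> = \<mu> * of_real V"
    by (simp add: V_def sum_distrib_left)
  finally have S_eq: "S = \<mu> * of_real V" .
  have "S = (\<Sum>j<n. \<Sum>i<n. of_real (a i j) * (cnj (v i) * (v i - v j)))"
    unfolding S_def by (rule sum.swap)
  also have "\<dots> = (\<Sum>i<n. \<Sum>j<n. of_real (a i j) * (cnj (v j) * (v j - v i)))"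
    by (intro sum.cong refl) (simp add: sym)
  finally have "S + S = (\<Sum>i<n. \<Sum>j<n. of_real (a i j) * (cnj (v i) * (v i - v j)))
      + (\<Sum>i<n. \<Sum>j<n. of_real (a i j) * (cnj (v j) * (v j - v i)))"
    by (simp add: S_def)
  also have "\<dots> = of_real E"
    unfolding E_def of_real_sum sum.distrib[symmetric]
    by (intro sum.cong refl) (simp add: complex_norm_square algebra_simps del: of_real_power)
  finally have "of_real E = 2 * \<mu> * of_real V"
    by (simp add: S_eq mult.assoc)
  moreover have "(cmod (v k))\<^sup>2 \<le> V"
    unfolding V_def using nonzero by (intro member_le_sum) auto
  then have "V > 0" using nonzero by (smt (verit) zero_less_power2 norm_eq_zero)
  ultimately have "\<mu> = of_real (E / (2 * V))"
    by (simp add: field_simps)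
  moreover have "0 \<le> E"
    unfolding E_def using nonneg by (intro sum_nonneg) auto
  ultimately show ?thesis using \<open>V > 0\<close> by (intro exI[of _ "E / (2 * V)"]) simp
qed

text \<open>
The linear factors exist over the complex numbers, and the Dirichlet form shows that all the roots
are real already.
\<close>

lemma char_poly_laplacian_splits:
  fixes L :: "real mat"
  assumes L: "L \<in> carrier_mat n n"
    and sym: "\<And>i j. i < n \<Longrightarrow> j < n \<Longrightarrow> L $$ (i, j) = L $$ (j, i)"
    and off_diag: "\<And>i j. i < n \<Longrightarrow> j < n \<Longrightarrow> i \<noteq> j \<Longrightarrow> L $$ (i, j) \<le> 0"
    and row_sum: "\<And>i. i < n \<Longrightarrow> (\<Sum>j<n. L $$ (i, j)) = 0"
  shows "\<exists>rs. char_poly L = (\<Prod>r\<leftarrow>rs. [:- r, 1:]) \<and> length rs = n \<and> (\<forall>r\<in>set rs. 0 \<le> r)"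
proof -
  define L' where "L' = map_mat complex_of_real L"
  have L': "L' \<in> carrier_mat n n" using L by (simp add: L'_def)
  obtain zs where zs: "char_poly L' = (\<Prod>z\<leftarrow>zs. [:- z, 1:])" "length zs = n"
    using char_poly_factorized[OF L'] by blast
  have real: "\<exists>r\<ge>0. z = of_real r" if z: "z \<in> set zs" for z
  proof -
    have "poly (char_poly L') z = 0"
      using z by (auto simp: zs(1) poly_prod_list prod_list_zero_iff)
    then obtain v where v: "v \<in> carrier_vec n" "v \<noteq> 0\<^sub>v n" "L' *\<^sub>v v = z \<cdot>\<^sub>v v"
      using eigenvalue_root_char_poly[OF L'] L' by (auto simp: eigenvalue_def eigenvector_def)
    then obtain k where k: "k < n" "v $ k \<noteq> 0"
      by (metis carrier_vecD eq_vecI index_zero_vec)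
    \<comment> \<open>The diagonal weight multiplies a zero difference; 0 keeps it nonnegative.\<close>
    define a where "a i j = (if i = j then 0 else - L $$ (i, j))" for i j
    show ?thesis
    proof (rule real_nonneg_of_laplacian_equation[where a = a and v = "\<lambda>i. v $ i"])
      fix i assume i: "i < n"
      have "z * v $ i = (L' *\<^sub>v v) $ i" unfolding v(3) using i v(1) by simp
      also have "\<dots> = (\<Sum>j<n. of_real (L $$ (i, j)) * v $ j)"
        using i L v(1) by (simp add: L'_def scalar_prod_def lessThan_atLeast0)
      also have "\<dots> = (\<Sum>j<n. of_real (L $$ (i, j)) * v $ j) - of_real (\<Sum>j<n. L $$ (i, j)) * v $ i"
        by (simp add: row_sum[OF i])
      also have "\<dots> = (\<Sum>j<n. of_real (a i j) * (v $ i - v $ j))"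
        unfolding of_real_sum sum_distrib_right sum_subtractf[symmetric]
        by (intro sum.cong refl) (simp add: a_def algebra_simps)
      finally show "(\<Sum>j<n. of_real (a i j) * (v $ i - v $ j)) = z * v $ i" ..
    qed (use k sym off_diag in \<open>auto simp: a_def\<close>)
  qed
  interpret of_real: map_poly_inj_idom_hom "of_real :: real \<Rightarrow> complex" ..
  have Re: "complex_of_real (Re z) = z" if "z \<in> set zs" for z
    using real[OF that] by auto
  define rs where "rs = map Re zs"
  have "map_poly complex_of_real (\<Prod>r\<leftarrow>rs. [:- r, 1:]) = (\<Prod>z\<leftarrow>zs. map_poly of_real [:- Re z, 1:])"
    by (simp add: rs_def of_real.hom_prod_list o_def)
  also have "\<dots> = (\<Prod>z\<leftarrow>zs. [:- z, 1:])"
    by (intro arg_cong[where f = prod_list] map_cong refl) (simp add: Re)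
  also have "\<dots> = map_poly of_real (char_poly L)"
    using zs(1) L by (simp add: L'_def of_real_hom.char_poly_hom)
  finally have "char_poly L = (\<Prod>r\<leftarrow>rs. [:- r, 1:])"
    by simp
  moreover have "\<forall>r\<in>set rs. 0 \<le> r"
    using real by (fastforce simp: rs_def)
  ultimately show ?thesis using zs(2) by (intro exI[of _ rs]) (simp add: rs_def)
qed

text \<open>
\<open>M\<close> is an inverse of \<open>L\<close> modulo the all-ones vector, so the deflations of \<open>M\<close> and \<open>L\<close> are
inverse to each other. This rules out a second zero eigenvalue and makes the trace of \<open>M\<close> the sum
of the inverses of the other eigenvalues.
\<close>

lemma laplacian_spectrum_trace:
  fixes L M :: "real mat"
  assumes L: "L \<in> carrier_mat (Suc n) (Suc n)" and M: "M \<in> carrier_mat (Suc n) (Suc n)"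
    and sym: "\<And>i j. i < Suc n \<Longrightarrow> j < Suc n \<Longrightarrow> L $$ (i, j) = L $$ (j, i)"
    and off_diag: "\<And>i j. i < Suc n \<Longrightarrow> j < Suc n \<Longrightarrow> i \<noteq> j \<Longrightarrow> L $$ (i, j) \<le> 0"
    and row_sum: "\<And>i. i < Suc n \<Longrightarrow> (\<Sum>j<Suc n. L $$ (i, j)) = 0"
    and row_sum_M: "\<And>i. i < Suc n \<Longrightarrow> (\<Sum>j<Suc n. M $$ (i, j)) = 0"
    and prod: "\<And>i j. i < Suc n \<Longrightarrow> j < Suc n \<Longrightarrow> (M * L) $$ (i, j) = (if i = j then 1 else 0) - c j"
  shows "\<exists>es. proots (char_poly L) = mset (0 # es) \<and> length es = n \<and> (\<forall>e\<in>set es. 0 < e)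
    \<and> (\<Sum>e\<leftarrow>es. 1 / e) = (\<Sum>i<Suc n. M $$ (i, i))"
proof -
  define q where "q = char_poly (deflate L)"
  have carr: "deflate L \<in> carrier_mat n n" "deflate M \<in> carrier_mat n n"
    using L M by auto
  have "deflate M * deflate L = deflate (M * L)"
    by (rule deflate_mult[OF M L row_sum_M])
  also have "\<dots> = 1\<^sub>m n"
    using L M by (intro eq_matI) (auto simp: deflate_def prod simp del: index_mult_mat(1))
  finally have inv: "deflate M * deflate L = 1\<^sub>m n" .
  have "(\<Sum>i<n. deflate M $$ (i, i)) = (\<Sum>i<Suc n. M $$ (i, i) - M $$ (0, i))"
    using M unfolding sum.lessThan_Suc_shift by (simp add: deflate_def)
  also have "\<dots> = (\<Sum>i<Suc n. M $$ (i, i))"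
    unfolding sum_subtractf using row_sum_M[of 0] by simp
  finally have trace: "(\<Sum>i<n. deflate M $$ (i, i)) = (\<Sum>i<Suc n. M $$ (i, i))" .
  note q' = pderiv_char_poly_0_left_inverse[OF carr inv, folded q_def, unfolded trace]
  obtain rs where rs: "char_poly L = (\<Prod>r\<leftarrow>rs. [:- r, 1:])" "length rs = Suc n"
      "\<forall>r\<in>set rs. 0 \<le> r"
    using char_poly_laplacian_splits[OF L sym off_diag row_sum] by auto
  have X_q: "char_poly L = [:0, 1:] * q"
    unfolding q_def by (rule char_poly_zero_row_sums[OF L row_sum])
  then have "poly (char_poly L) 0 = 0" by simp
  then have "0 \<in> set rs" by (auto simp: rs(1) poly_prod_list prod_list_zero_iff)
  then obtain xs ys where split: "rs = xs @ 0 # ys" by (meson split_list)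
  define es where "es = xs @ ys"
  have "[:0, 1:] * q = [:0, 1:] * (\<Prod>e\<leftarrow>es. [:- e, 1:])"
    unfolding X_q[symmetric] rs(1) split es_def
    by (simp only: map_append list.map prod_list.append prod_list.Cons mult.left_commute minus_zero)
  then have q_es: "q = (\<Prod>e\<leftarrow>es. [:- e, 1:])"
    by (subst (asm) mult_cancel_left) auto
  have "0 \<notin> set es"
    using q'(2) by (auto simp: q_es poly_prod_list prod_list_zero_iff)
  moreover have "set es \<subseteq> set rs" by (auto simp: split es_def)
  ultimately have pos: "0 < e" if "e \<in> set es" for e
    using that rs(3) by (metis order_le_less subsetD)
  have "(\<Sum>e\<leftarrow>es. 1 / e) = (\<Sum>i<Suc n. M $$ (i, i))"
    using sum_list_inverse_roots[OF \<open>0 \<notin> set es\<close>, folded q_es] q' by simp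
  moreover have "proots (char_poly L) = mset (0 # es)"
    unfolding rs(1) proots_linear_factors by (simp add: split es_def)
  ultimately show ?thesis
    using pos rs(2) by (intro exI[of _ es]) (simp add: split es_def)
qed

lemma sum_inverse_sorted_spectrum:
  fixes es :: "real list"
  assumes "\<forall>e\<in>set es. 0 < e" "length es = n"
  shows "(\<Sum>i = 2..Suc n. 1 / (2 * sorted_list_of_multiset (mset (0 # es)) ! (i - 1)))
    = (\<Sum>e\<leftarrow>es. 1 / e) / 2"
proof -
  \<comment> \<open>The zero comes first in the sorted list, so the positions from 1 on hold \<open>es\<close>.\<close>
  have "insort 0 (sort es) = 0 # sort es"
    using assms(1) by (cases "sort es") (auto simp: order_le_less dest!: arg_cong[where f = set])
  then have sort: "sorted_list_of_multiset (mset (0 # es)) = 0 # sort es"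
    by (simp only: sorted_list_of_multiset_mset) (simp add: sort_key_simps)
  have "(\<Sum>i = 2..Suc n. 1 / (2 * (0 # sort es) ! (i - 1))) = (\<Sum>i<n. 1 / (2 * sort es ! i))"
    by (rule sum.reindex_bij_witness[of _ "\<lambda>i. i + 2" "\<lambda>i. i - 2"]) (auto simp: nth_Cons' numeral_2_eq_2)
  also have "\<dots> = (\<Sum>e\<leftarrow>sort es. 1 / (2 * e))"
    using assms(2) by (simp add: sum_list_sum_nth lessThan_atLeast0)
  also have "\<dots> = sum_mset (image_mset (\<lambda>e. 1 / (2 * e)) (mset (sort es)))"
    by (simp only: sum_mset_sum_list mset_map[symmetric])
  also have "\<dots> = (\<Sum>e\<leftarrow>es. 1 / (2 * e))"
    by (simp only: mset_sort sum_mset_sum_list mset_map[symmetric])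
  also have "\<dots> = (\<Sum>e\<leftarrow>es. 1 / e) / 2"
    by (induction es) (auto simp: field_simps)
  finally show ?thesis unfolding sort .
qed

section \<open>Paths and distances in trees\<close>

text \<open>
The locale gives access to the walks of \<open>with_proj G\<close> without naming the projection.
\<close>

locale undirected_tree_graph = pair_graph G for G :: "'a pair_pre_digraph" +
  assumes undirected_tree: "undirected_tree G"
begin

lemma no_long_cycle: "cycle p \<Longrightarrow> length p < 3"
  using undirected_tree by (auto simp: undirected_tree_def not_le)

lemma pverts_nonempty: "pverts G \<noteq> {}"
  using undirected_tree by (auto simp: undirected_tree_def Digraph_Component.connected_conv)

text \<open>
After the common beginning of two paths, follow the first one up to the first vertex that lies on
the second one again, and return along the second one. This is a cycle, and it is longer than 2
because the first arcs differ.
\<close>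

lemma apath_unique:
  assumes "apath u p v" "apath u q v"
  shows "p = q"
  using assms
proof (induction p arbitrary: u q)
  case Nil
  then show ?case using apath_nonempty_ends[of u q v] by (auto simp: apath_Nil_iff)
next
  case (Cons e p')
  obtain f q' where q: "q = f # q'"
    using Cons.prems apath_nonempty_ends[OF Cons.prems(1)] by (cases q) (auto simp: apath_Nil_iff)
  have e: "e \<in> parcs G" "fst e = u" "apath (snd e) p' v" "u \<notin> set (pawalk_verts (snd e) p')"
    using Cons.prems(1) by (auto simp: apath_Cons_iff)
  have f: "fst f = u" "apath (snd f) q' v"
    using Cons.prems(2) by (auto simp: q apath_Cons_iff)
  show ?case
  proof (cases "e = f")
    case True
    then show ?thesis using Cons.IH[OF e(3)] f by (simp add: q)
  next
    case False
    have p'_walk: "awalk (snd e) p' v" and q_walk: "awalk u q v" and q_dist: "distinct (pawalk_verts u q)"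
      using e(3) Cons.prems(2) by (auto simp: apath_def)
    then have cas: "pcas (snd e) p' v" "pcas u q v"
      by (auto elim!: awalkE')
    have "v \<in> set (pawalk_verts (snd e) p')" "v \<in> set (pawalk_verts u q)"
      using p'_walk q_walk by (metis awalkE' awalk_verts_non_Nil last_in_set)+
    then obtain xs x ys where first: "pawalk_verts (snd e) p' = xs @ x # ys"
        "x \<in> set (pawalk_verts u q)" "\<forall>y\<in>set xs. y \<notin> set (pawalk_verts u q)"
      using split_list_first_prop[of "pawalk_verts (snd e) p'" "\<lambda>y. y \<in> set (pawalk_verts u q)"]
      by blast
    obtain p1 p2 where p1: "pcas (snd e) p1 x" "p' = p1 @ p2" "pawalk_verts (snd e) p1 = xs @ [x]"
      using awalk_decomp_verts[OF cas(1) first(1)] by metis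
    obtain zs ws where zs: "pawalk_verts u q = zs @ x # ws"
      using first(2) by (meson split_list)
    obtain q1 q2 where q1: "pcas u q1 x" "q = q1 @ q2" "pawalk_verts u q1 = zs @ [x]"
      using awalk_decomp_verts[OF cas(2) zs] by metis
    have "x \<noteq> u" using e(4) first(1) by auto
    then have "q1 \<noteq> []" using q1(1) by auto
    have walks: "awalk (snd e) p1 x" "awalk u q1 x"
      using p'_walk q_walk p1(1,2) q1(1,2) by (auto simp: awalk_def)
    let ?c = "(e # p1) @ rev_path q1"
    have "awalk u (e # p1) x"
      using e(1,2) walks(1) by (simp add: awalk_Cons_iff)
    then have walk_c: "awalk u ?c u"
      using walks(2) by (intro awalk_appendI[of _ _ x]) auto
    have "pawalk_verts u ?c = pawalk_verts u (e # p1) @ tl (pawalk_verts (last (pawalk_verts u (e # p1))) (rev_path q1))"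
      using awalk_verts_append[OF walk_c] .
    also have "last (pawalk_verts u (e # p1)) = x"
      using p1(3) by simp
    also have "pawalk_verts x (rev_path q1) = x # rev zs"
      using awalk_verts_rev_path[OF walks(2)] q1(3) by simp
    finally have "tl (pawalk_verts u ?c) = xs @ x # rev zs"
      using p1(3) by simp
    moreover have "distinct (xs @ x # rev zs)"
      using e(3) q_dist first(1,3) zs by (auto simp: apath_def)
    ultimately have "cycle ?c"
      unfolding cycle_def using walk_c by auto
    then have "length ?c < 3" by (rule no_long_cycle)
    then have "p1 = []" "length q1 = 1"
      using \<open>q1 \<noteq> []\<close> by (cases p1; cases q1 rule: rev_cases; auto)+
    then have "x = snd e" "q1 = [f]"
      using p1(1) q1(2) q by (auto simp: length_Suc_conv)
    then have "e = f"
      using e(2) f(1) q1(1) by (auto simp: prod_eq_iff)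
    then show ?thesis using False by simp
  qed
qed

lemma tree_dist_eq_length: "apath u p v \<Longrightarrow> tree_dist G u v = length p"
  unfolding tree_dist_def by (metis apath_unique theI)

lemma apath_exists:
  assumes "u \<in> pverts G" "v \<in> pverts G"
  obtains p where "apath u p v"
proof -
  have "strongly_connected (with_proj G)"
    using undirected_tree pair_sym_arcs
    by (intro symmetric_connected_imp_strongly_connected) (auto simp: undirected_tree_def)
  then have "u \<rightarrow>\<^sup>*\<^bsub>with_proj G\<^esub> v" using assms by auto
  then show ?thesis using reachable_apath that by blast
qed

lemma tree_dist_self: "u \<in> pverts G \<Longrightarrow> tree_dist G u u = 0"
  using tree_dist_eq_length[of u "[]" u] by (simp add: apath_Nil_iff)

text \<open>
The nearer neighbour is the second vertex of the path to \<open>v\<close>. Another neighbour \<open>w\<close> is not on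
that path, because the arc is the only path from \<open>u\<close> to \<open>w\<close>; hence the path can be prolonged
to \<open>w\<close>.
\<close>

lemma unique_nearer_neighbour:
  assumes "u \<in> pverts G" "v \<in> pverts G" "u \<noteq> v"
  shows "\<exists>w\<^sub>0. (u, w\<^sub>0) \<in> parcs G \<and> tree_dist G u v = Suc (tree_dist G w\<^sub>0 v) \<and>
    (\<forall>w. (u, w) \<in> parcs G \<and> w \<noteq> w\<^sub>0 \<longrightarrow> tree_dist G w v = Suc (tree_dist G u v))"
proof -
  obtain p where p: "apath u p v" using apath_exists[OF assms(1,2)] .
  obtain w\<^sub>0 p' where p_Cons: "p = (u, w\<^sub>0) # p'"
    using p assms(3) by (cases p) (auto simp: apath_simps)
  have p': "apath w\<^sub>0 p' v" and arc: "(u, w\<^sub>0) \<in> parcs G"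
    using p by (auto simp: p_Cons apath_Cons_iff)
  show ?thesis
  proof (intro exI[of _ w\<^sub>0] conjI allI impI; (elim conjE)?)
    show "(u, w\<^sub>0) \<in> parcs G" by fact
    show "tree_dist G u v = Suc (tree_dist G w\<^sub>0 v)"
      using tree_dist_eq_length[OF p] tree_dist_eq_length[OF p'] by (simp add: p_Cons)
  next
    fix w assume w: "(u, w) \<in> parcs G" "w \<noteq> w\<^sub>0"
    have "w \<notin> set (pawalk_verts u p)"
    proof
      assume "w \<in> set (pawalk_verts u p)"
      then obtain q r where split: "p = q @ r" "awalk u q w"
        using awalk_decomp[of u p v w] p by (auto simp: apath_def)
      then have "apath u q w"
        using p by (auto simp: apath_append_iff)
      moreover have "apath u [(u, w)] w"
        using w no_loops'[OF w(1)] by (auto simp: apath_simps wellformed')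
      ultimately have "q = [(u, w)]" by (rule apath_unique)
      then show False using split(1) w(2) by (simp add: p_Cons)
    qed
    then have "apath w ((w, u) # p) v"
      using p arcs_symmetric[OF w(1)] by (auto simp: apath_Cons_iff)
    then show "tree_dist G w v = Suc (tree_dist G u v)"
      using tree_dist_eq_length[OF p] tree_dist_eq_length by fastforce
  qed
qed

end

section \<open>The norm of a tree and its distances\<close>

context undirected_tree_graph begin

text \<open>
One neighbour is nearer by one and all the others are farther by one, except at \<open>v\<close> itself, where
all neighbours have distance 1. In matrix form, the distance matrix \<open>D\<close> satisfies
\<open>D L = -2 I + \<one> \<tau>\<^sup>T\<close> with \<open>\<tau>\<^sub>v = 2 - deg v\<close>.
\<close>

lemma sum_tree_dist_neighbours:
  assumes u: "u \<in> pverts G" and v: "v \<in> pverts G"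
  shows "(\<Sum>w | (u, w) \<in> parcs G. real (tree_dist G w v))
    = (if u = v then 2 else 0) - 2 + card {w. (u, w) \<in> parcs G} * (real (tree_dist G u v) + 1)"
proof -
  define W where "W = {w. (u, w) \<in> parcs G}"
  have fin: "finite W"
    by (rule finite_subset[OF _ pair_finite_verts]) (auto simp: W_def wellformed')
  show ?thesis
  proof (cases "u = v")
    case True
    have "tree_dist G w v = 1" if "w \<in> W" for w
    proof -
      have "apath w [(w, u)] u"
        using that no_loops'[of u w] arcs_symmetric[of u w]
        by (auto simp: W_def apath_simps wellformed')
      then show ?thesis using tree_dist_eq_length True by fastforce
    qed
    then have "(\<Sum>w\<in>W. real (tree_dist G w v)) = card W" by simp
    then show ?thesis using True u by (simp add: W_def tree_dist_self)
  next
    case False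
    obtain w\<^sub>0 where w\<^sub>0: "w\<^sub>0 \<in> W" "tree_dist G u v = Suc (tree_dist G w\<^sub>0 v)"
      "\<And>w. w \<in> W \<Longrightarrow> w \<noteq> w\<^sub>0 \<Longrightarrow> tree_dist G w v = Suc (tree_dist G u v)"
      using unique_nearer_neighbour[OF u v False] by (auto simp: W_def)
    have "(\<Sum>w\<in>W. real (tree_dist G w v))
        = real (tree_dist G w\<^sub>0 v) + (\<Sum>w\<in>W - {w\<^sub>0}. real (tree_dist G u v) + 1)"
      using w\<^sub>0(1) fin by (subst sum.remove[of W w\<^sub>0]) (auto intro!: sum.cong simp: w\<^sub>0(3))
    moreover have "real (card (W - {w\<^sub>0})) = real (card W) - 1"
      using w\<^sub>0(1) fin card_gt_0_iff[of W] by (subst card_Diff_singleton) (auto simp: of_nat_diff Suc_le_eq)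
    ultimately show ?thesis using False w\<^sub>0(2) by (simp add: W_def[symmetric] algebra_simps)
  qed
qed

end

text \<open>
By the neighbour identity, \<open>- D / 2\<close> inverts the Laplacian modulo the all-ones vector. Adding to each
row of \<open>- D / 2\<close> half its mean distance makes the row sums vanish and does not change the product with
the Laplacian. The trace of the resulting matrix \<open>M\<close> is the sum of all distances divided by twice the
number of vertices.
\<close>

lemma H2_norm_tree:
  fixes G :: "'a::linorder pair_pre_digraph"
  assumes "undirected_tree G"
  shows "H2_norm G = sqrt ((\<Sum>u\<in>pverts G. \<Sum>v\<in>pverts G. real (tree_dist G u v)) / (4 * card (pverts G)))"
proof -
  interpret pair_graph G using assms by (simp add: undirected_tree_def)
  interpret undirected_tree_graph G using assms by unfold_locales
  define V where "V = pverts G"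
  define x where "x i = vertex_list G ! i" for i
  define a where "a u v = (if (u, v) \<in> parcs G then 1 else 0 :: real)" for u v
  define deg where "deg u = (\<Sum>v\<in>V. a u v)" for u
  define d where "d u v = real (tree_dist G v u)" for u v
  define r where "r u = (\<Sum>v\<in>V. d u v)" for u
  have fin: "finite V" by (simp add: V_def)
  define n where "n = card V - 1"
  have card_V: "card V = Suc n"
    using fin pverts_nonempty by (simp add: n_def V_def card_gt_0_iff)
  have bij: "bij_betw x {..<Suc n} V"
    unfolding x_def vertex_list_def V_def[symmetric] card_V[symmetric]
    using fin by (intro bij_betw_nth) auto
  have sum_x: "(\<Sum>i<Suc n. f (x i)) = (\<Sum>v\<in>V. f v)" for f :: "'a \<Rightarrow> real"
    using sum.reindex_bij_betw[OF bij] .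
  have x_in: "x i \<in> V" if "i < Suc n" for i
    using bij_betwE[OF bij] that by blast
  have x_eq: "x i = x j \<longleftrightarrow> i = j" if "i < Suc n" "j < Suc n" for i j
    using bij that by (auto simp: bij_betw_def inj_on_def)
  have a_sym: "a u v = a v u" for u v
    using arcs_symmetric by (auto simp: a_def)
  have sum_a: "(\<Sum>v\<in>V. f v * a u v) = (\<Sum>v | (u, v) \<in> parcs G. f v)" for f u
  proof -
    have "(\<Sum>v\<in>V. f v * a u v) = (\<Sum>v\<in>V. if (u, v) \<in> parcs G then f v else 0)"
      by (intro sum.cong) (auto simp: a_def)
    also have "\<dots> = (\<Sum>v\<in>{v \<in> V. (u, v) \<in> parcs G}. f v)"
      using fin by (rule sum.inter_filter[symmetric])
    also have "{v \<in> V. (u, v) \<in> parcs G} = {v. (u, v) \<in> parcs G}"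
      by (auto simp: V_def wellformed')
    finally show ?thesis .
  qed
  have deg_card: "deg u = card {w. (u, w) \<in> parcs G}" for u
    using sum_a[of "\<lambda>_. 1" u] by (simp add: deg_def)
  have out_degree: "real (out_degree (with_proj G) u) = deg u" for u
  proof -
    have "out_arcs (with_proj G) u = Pair u ` {w. (u, w) \<in> parcs G}"
      by (auto simp: out_arcs_def)
    then show ?thesis
      by (simp add: out_degree_def deg_card card_image inj_on_def)
  qed
  define L where "L = laplacian G"
  have L: "L \<in> carrier_mat (Suc n) (Suc n)"
    unfolding L_def laplacian_def
    by (rule minus_carrier_mat) (simp add: adjacency_mat_def card_V[unfolded V_def])
  have L_index: "L $$ (i, j) = (if i = j then deg (x i) else 0) - a (x i) (x j)"
    if "i < Suc n" "j < Suc n" for i j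
    using that by (simp add: L_def laplacian_def degree_mat_def adjacency_mat_def
      card_V[unfolded V_def] out_degree x_def a_def)
  define M where "M = mat (Suc n) (Suc n) (\<lambda>(i, j). (r (x i) / card V - d (x i) (x j)) / 2)"
  have M: "M \<in> carrier_mat (Suc n) (Suc n)" by (simp add: M_def)
  have sym: "L $$ (i, j) = L $$ (j, i)" if "i < Suc n" "j < Suc n" for i j
    using that a_sym by (auto simp: L_index)
  have row_sum: "(\<Sum>j<Suc n. L $$ (i, j)) = 0" if "i < Suc n" for i
  proof -
    have "(\<Sum>j<Suc n. L $$ (i, j)) = (\<Sum>j<Suc n. if i = j then deg (x i) else 0) - (\<Sum>j<Suc n. a (x i) (x j))"
      unfolding sum_subtractf[symmetric] using that by (intro sum.cong) (auto simp: L_index)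
    also have "\<dots> = 0"
      using that unfolding sum_x deg_def by (simp add: sum.delta del: sum.lessThan_Suc)
    finally show ?thesis .
  qed
  have row_sum_M: "(\<Sum>j<Suc n. M $$ (i, j)) = 0" if "i < Suc n" for i
  proof -
    have "(\<Sum>j<Suc n. M $$ (i, j)) = (\<Sum>j<Suc n. (r (x i) / card V - d (x i) (x j)) / 2)"
      using that by (intro sum.cong) (auto simp: M_def)
    also have "\<dots> = 0"
      unfolding sum_divide_distrib[symmetric] sum_subtractf sum_x
      by (simp add: r_def card_V del: sum.lessThan_Suc)
    finally show ?thesis .
  qed
  have DL: "(\<Sum>k<Suc n. d (x i) (x k) * L $$ (k, j)) = (if i = j then -2 else 0) + 2 - deg (x j)"
    if ij: "i < Suc n" "j < Suc n" for i j
  proof -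
    have "(\<Sum>k<Suc n. d (x i) (x k) * L $$ (k, j))
        = (\<Sum>k<Suc n. if k = j then d (x i) (x j) * deg (x j) else 0)
          - (\<Sum>k<Suc n. d (x i) (x k) * a (x j) (x k))"
      unfolding sum_subtractf[symmetric] using ij a_sym
      by (intro sum.cong) (auto simp: L_index algebra_simps)
    also have "\<dots> = d (x i) (x j) * deg (x j) - (\<Sum>w | (x j, w) \<in> parcs G. d (x i) w)"
      using ij unfolding sum_x[of "\<lambda>w. d (x i) w * a (x j) w"] sum_a by (simp del: sum.lessThan_Suc)
    also have "\<dots> = (if i = j then -2 else 0) + 2 - deg (x j)"
      using sum_tree_dist_neighbours[of "x j" "x i"] x_in[OF ij(1)] x_in[OF ij(2)] x_eq[OF ij(2,1)]
      by (cases "i = j") (simp_all add: d_def deg_card V_def algebra_simps)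
    finally show ?thesis .
  qed
  have prod: "(M * L) $$ (i, j) = (if i = j then 1 else 0) - (1 - deg (x j) / 2)"
    if ij: "i < Suc n" "j < Suc n" for i j
  proof -
    have "(M * L) $$ (i, j) = (\<Sum>k<Suc n. M $$ (i, k) * L $$ (k, j))"
      by (rule index_mult_mat_sum[OF M L ij])
    also have "\<dots> = (\<Sum>k<Suc n. r (x i) / (2 * card V) * L $$ (j, k) - d (x i) (x k) * L $$ (k, j) / 2)"
    proof (rule sum.cong)
      fix k assume "k \<in> {..<Suc n}"
      then have k: "k < Suc n" by simp
      show "M $$ (i, k) * L $$ (k, j)
          = r (x i) / (2 * card V) * L $$ (j, k) - d (x i) (x k) * L $$ (k, j) / 2"
        unfolding sym[OF ij(2) k] using ij k by (simp add: M_def diff_divide_distrib left_diff_distrib)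
    qed simp
    also have "\<dots> = r (x i) / (2 * card V) * (\<Sum>k<Suc n. L $$ (j, k))
        - (\<Sum>k<Suc n. d (x i) (x k) * L $$ (k, j)) / 2"
      unfolding sum_subtractf sum_distrib_left sum_divide_distrib ..
    also have "\<dots> = (if i = j then 1 else 0) - (1 - deg (x j) / 2)"
      unfolding row_sum[OF ij(2)] DL[OF ij] by (simp add: field_simps)
    finally show ?thesis .
  qed
  have off_diag: "L $$ (i, j) \<le> 0" if "i < Suc n" "j < Suc n" "i \<noteq> j" for i j
    using that by (simp add: L_index a_def)
  obtain es where es: "proots (char_poly L) = mset (0 # es)" "length es = n"
      "\<forall>e\<in>set es. 0 < e" "(\<Sum>e\<leftarrow>es. 1 / e) = (\<Sum>i<Suc n. M $$ (i, i))"
    using laplacian_spectrum_trace[OF L M sym off_diag row_sum row_sum_M prod] by blast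
  have "(\<Sum>i<Suc n. M $$ (i, i)) = (\<Sum>i<Suc n. r (x i) / (2 * card V))"
    using x_in tree_dist_self by (intro sum.cong) (auto simp: M_def d_def V_def)
  also have "\<dots> = (\<Sum>u\<in>V. r u) / (2 * card V)"
    unfolding sum_x[of "\<lambda>u. r u / (2 * card V)"] sum_divide_distrib ..
  also have "(\<Sum>u\<in>V. r u) = (\<Sum>u\<in>V. \<Sum>v\<in>V. real (tree_dist G u v))"
    unfolding r_def d_def by (rule sum.swap)
  finally have "(\<Sum>e\<leftarrow>es. 1 / e) / 2 = (\<Sum>u\<in>V. \<Sum>v\<in>V. real (tree_dist G u v)) / (4 * card V)"
    by (simp add: es(4))
  then show ?thesis
    unfolding H2_norm_def laplacian_eigenvalues_def L_def[symmetric] es(1) V_def[symmetric] card_V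
    by (subst sum_inverse_sorted_spectrum[OF es(3,2)]) (simp_all add: card_V field_simps)
qed

section \<open>A path with leaves at one vertex\<close>

text \<open>
A long cycle would contain two different neighbours of its largest vertex, both of them smaller.
\<close>

lemma undirected_treeI_smaller_neighbour:
  fixes G :: "'a::wellorder pair_pre_digraph"
  assumes "pair_graph G" and root: "r\<^sub>0 \<in> pverts G"
    and ex: "\<And>v. v \<in> pverts G \<Longrightarrow> v \<noteq> r\<^sub>0 \<Longrightarrow> \<exists>w<v. (v, w) \<in> parcs G"
    and uniq: "\<And>v a b. (v, a) \<in> parcs G \<Longrightarrow> (v, b) \<in> parcs G \<Longrightarrow> a < v \<Longrightarrow> b < v \<Longrightarrow> a = b"
  shows "undirected_tree G"
  unfolding undirected_tree_def
proof (intro conjI notI)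
  interpret pair_graph G by fact
  show "pair_graph G" by fact
  have to_root: "\<exists>p. awalk v p r\<^sub>0" if "v \<in> pverts G" for v
    using that
  proof (induction v rule: less_induct)
    case (less v)
    show ?case
    proof (cases "v = r\<^sub>0")
      case True
      then show ?thesis using root by (auto intro!: exI[of _ "[]"] simp: awalk_Nil_iff)
    next
      case False
      then obtain w where "w < v" "(v, w) \<in> parcs G" using ex less.prems by blast
      moreover from this obtain p where "awalk w p r\<^sub>0"
        using less.IH in_arcsD2 by blast
      ultimately have "awalk v ((v, w) # p) r\<^sub>0" by (simp add: awalk_Cons_iff)
      then show ?thesis by blast
    qed
  qed
  have "u \<rightarrow>\<^sup>*\<^bsub>with_proj G\<^esub> v" if uv: "u \<in> pverts G" "v \<in> pverts G" for u v
  proof -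
    obtain p q where "awalk u p r\<^sub>0" "awalk v q r\<^sub>0" using to_root uv by blast
    then have "awalk u (p @ rev_path q) v" by (intro awalk_appendI[of _ _ r\<^sub>0]) auto
    then show ?thesis using reachable_awalk by blast
  qed
  moreover have "(parcs G)\<^sup>s = parcs G"
    using arcs_symmetric by (auto simp: symcl_def)
  ultimately show "Digraph_Component.connected (with_proj G)"
    using root by (auto simp: Digraph_Component.connected_conv reachable_def)
next
  interpret pair_graph G by fact
  assume "\<exists>p. cycle p \<and> 3 \<le> length p"
  then obtain u p where p: "awalk u p u" "distinct (tl (pawalk_verts u p))" "3 \<le> length p"
    by (auto simp: cycle_def)
  define m where "m = Max (set (pawalk_verts u p))"
  have max: "x \<le> m" if "x \<in> set (pawalk_verts u p)" for x
    using that by (simp add: m_def)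
  have "m \<in> set (pawalk_verts u p)"
    unfolding m_def by (intro Max_in) (auto simp: awalk_verts_conv)
  then obtain q r where split: "p = q @ r" "awalk u q m" "awalk m r u"
    using awalk_decomp[OF p(1)] by blast
  have "pcas u p u" using p(1) by (auto simp: awalk_def)
  then have snd_verts: "tl (pawalk_verts u p) = map snd p"
    using awalk_verts_conv' p(3) by auto
  obtain e es f where rot: "r @ q = e # es @ [f]" "es \<noteq> []"
  proof -
    have len: "3 \<le> length (r @ q)" using p(3) split(1) by simp
    then obtain e t where t: "r @ q = e # t" by (cases "r @ q") auto
    then obtain es f where "t = es @ [f]" using len by (cases t rule: rev_cases) auto
    then show ?thesis using that[of e es f] t len by (cases es) auto
  qed
  \<comment> \<open>Rotated to start at its largest vertex, the cycle begins and ends with arcs at that vertex.\<close>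
  have walk: "awalk m (e # es @ [f]) m"
    unfolding rot(1)[symmetric] using split(2,3) by (rule_tac awalk_appendI)
  obtain es' g where g: "es = es' @ [g]" using rot(2) by (cases es rule: rev_cases) auto
  have e: "e = (m, snd e)" "e \<in> parcs G" and f: "f = (snd g, m)" "f \<in> parcs G"
    using walk by (auto simp: awalk_Cons_iff g awalk_verts_conv prod_eq_iff)
  have "set (e # es @ [f]) = set p"
    using rot(1) split(1) by (metis set_append sup_commute)
  then have "e \<in> set p" "g \<in> set p"
    unfolding g by auto
  then have "snd e \<in> set (map snd p)" "snd g \<in> set (map snd p)"
    by auto
  then have "snd e \<le> m" "snd g \<le> m"
    using max list.set_sel(2)[of "pawalk_verts u p"] by (auto simp flip: snd_verts)
  moreover have "snd e \<noteq> m" "snd g \<noteq> m"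
    using no_loops'[of m "snd e"] no_loops'[of "snd g" m] e f by auto
  ultimately have "snd e = snd g"
    using uniq[of m "snd e" "snd g"] e f arcs_symmetric[of "snd g" m] by auto
  moreover have "distinct (map snd (e # es @ [f]))"
    unfolding rot(1)[symmetric] using p(2) unfolding snd_verts by (auto simp: split(1))
  ultimately show False by (simp add: g)
qed

text \<open>
Descending along \<open>\<delta>\<close> gives a walk that never repeats a vertex, hence the path.
\<close>

lemma (in undirected_tree_graph) tree_dist_eqI:
  fixes \<delta> :: "'a \<Rightarrow> nat"
  assumes v: "\<delta> v = 0"
    and step: "\<And>u. u \<in> pverts G \<Longrightarrow> u \<noteq> v \<Longrightarrow> \<exists>w. (u, w) \<in> parcs G \<and> \<delta> u = Suc (\<delta> w)"
    and u: "u \<in> pverts G"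
  shows "tree_dist G u v = \<delta> u"
proof -
  have "\<exists>p. apath u p v \<and> length p = \<delta> u \<and> (\<forall>x\<in>set (pawalk_verts u p). \<delta> x \<le> \<delta> u)"
    using u
  proof (induction "\<delta> u" arbitrary: u rule: less_induct)
    case less
    show ?case
    proof (cases "u = v")
      case True
      then show ?thesis using v less.prems by (intro exI[of _ "[]"]) (auto simp: apath_Nil_iff)
    next
      case False
      then obtain w where w: "(u, w) \<in> parcs G" "\<delta> u = Suc (\<delta> w)"
        using step less.prems by blast
      then obtain p where p: "apath w p v" "length p = \<delta> w" "\<forall>x\<in>set (pawalk_verts w p). \<delta> x \<le> \<delta> w"
        using less.hyps[of w] by (auto simp: wellformed')
      then have "u \<notin> set (pawalk_verts w p)" using w(2) by auto
      then show ?thesis using p w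
        by (intro exI[of _ "(u, w) # p"]) (auto simp: apath_Cons_iff)
    qed
  qed
  then show ?thesis using tree_dist_eq_length by auto
qed

lemma P_tree_verts [simp]: "pverts (P_tree N d i) = {0..<N}"
  by (simp add: P_tree_def Let_def)

lemma P_tree_arc_iff:
  "(a, b) \<in> parcs (P_tree N d i) \<longleftrightarrow>
     b = Suc a \<and> a < d \<or> a = Suc b \<and> b < d \<or> a = i \<and> d < b \<and> b < N \<or> b = i \<and> d < a \<and> a < N"
  by (auto simp: P_tree_def Let_def)

lemma pair_graph_P_tree:
  assumes "d < N" "i \<le> d"
  shows "pair_graph (P_tree N d i)"
proof
  show "finite (parcs (P_tree N d i))"
    by (rule finite_subset[of _ "{0..<N} \<times> {0..<N}"]) (use assms in \<open>auto simp: P_tree_arc_iff\<close>)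
  show "symmetric (with_proj (P_tree N d i))"
    by (auto simp: symmetric_def sym_def P_tree_arc_iff)
qed (use assms in \<open>auto simp: P_tree_arc_iff\<close>)

lemma undirected_tree_P_tree:
  assumes "d < N" "i \<le> d"
  shows "undirected_tree (P_tree N d i)"
proof (rule undirected_treeI_smaller_neighbour[OF pair_graph_P_tree[OF assms], of 0])
  fix v assume v: "v \<in> pverts (P_tree N d i)" "v \<noteq> 0"
  show "\<exists>w<v. (v, w) \<in> parcs (P_tree N d i)"
  proof (cases "v \<le> d")
    case True
    then show ?thesis using v by (intro exI[of _ "v - 1"]) (auto simp: P_tree_arc_iff)
  next
    case False
    then show ?thesis using v assms by (intro exI[of _ i]) (auto simp: P_tree_arc_iff)
  qed
qed (use assms in \<open>auto simp: P_tree_arc_iff\<close>)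

text \<open>
Every vertex is a path vertex, its foot, or a leaf attached to its foot at height 1. The path between
different vertices goes down to the foot, along the long path, and up again.
\<close>

definition P_dist :: "nat \<Rightarrow> nat \<Rightarrow> nat \<Rightarrow> nat \<Rightarrow> nat" where
  "P_dist d i u v =
     (let foot = (\<lambda>x. if x \<le> d then x else i); height = (\<lambda>x. if x \<le> d then 0 else 1)
      in if u = v then 0
         else (foot u - foot v) + (foot v - foot u) + height u + height v)"

lemma tree_dist_P_tree:
  assumes "d < N" "i \<le> d" "u < N" "v < N"
  shows "tree_dist (P_tree N d i) u v = P_dist d i u v"
proof -
  interpret undirected_tree_graph "P_tree N d i"
    using pair_graph_P_tree[OF assms(1,2)] undirected_tree_P_tree[OF assms(1,2)]
    by (simp add: undirected_tree_graph_def undirected_tree_graph_axioms_def)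
  show ?thesis
  proof (rule tree_dist_eqI)
    fix u assume "u \<in> pverts (P_tree N d i)" "u \<noteq> v"
    then have u: "u < N" "u \<noteq> v" by auto
    \<comment> \<open>The foot of the target.\<close>
    define t where "t = (if v \<le> d then v else i)"
    have "t \<le> d" using assms(2) by (simp add: t_def)
    consider "d < u" | "u \<le> d" "u < t" | "u \<le> d" "t < u" | "u = t" "d < v"
      using u(2) unfolding t_def by (metis not_le nat_neq_iff)
    then show "\<exists>w. (u, w) \<in> parcs (P_tree N d i) \<and> P_dist d i u v = Suc (P_dist d i w v)"
    proof cases
      case 1
      then show ?thesis using u assms(2) by (intro exI[of _ i]) (auto simp: P_tree_arc_iff P_dist_def)
    next
      case 2
      then show ?thesis using u assms \<open>t \<le> d\<close>
        by (intro exI[of _ "Suc u"]) (auto simp: P_tree_arc_iff P_dist_def t_def split: if_splits)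
    next
      case 3
      then show ?thesis using u assms
        by (intro exI[of _ "u - 1"]) (auto simp: P_tree_arc_iff P_dist_def t_def split: if_splits)
    next
      case 4
      then show ?thesis using u assms
        by (intro exI[of _ v]) (auto simp: P_tree_arc_iff P_dist_def t_def split: if_splits)
    qed
  qed (use assms in \<open>auto simp: P_dist_def\<close>)
qed

lemma tree_diameter_P_tree:
  assumes "d < N" "0 < i" "i < d"
  shows "tree_diameter (P_tree N d i) = d"
  unfolding tree_diameter_def
proof (rule Max_eqI)
  let ?D = "{tree_dist (P_tree N d i) u v |u v. u \<in> pverts (P_tree N d i) \<and> v \<in> pverts (P_tree N d i)}"
  have "?D = (\<lambda>(u, v). tree_dist (P_tree N d i) u v) ` ({0..<N} \<times> {0..<N})"
    by force
  then show "finite ?D" by simp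
  have "d = tree_dist (P_tree N d i) 0 d"
    using assms by (simp add: tree_dist_P_tree P_dist_def)
  then show "d \<in> ?D"
    using assms by fastforce
  show "x \<le> d" if "x \<in> ?D" for x
    using that assms by (auto simp: tree_dist_P_tree P_dist_def)
qed

lemma P_tree_in_trees:
  assumes "d < N" "0 < i" "i < d"
  shows "P_tree N d i \<in> trees N d"
  using assms undirected_tree_P_tree[of d N i] tree_diameter_P_tree[of d N i] by (simp add: trees_def)

section \<open>Trees with two more vertices than their diameter\<close>

text \<open>
The graphs have no parallel arcs, so a bijection of the vertices that respects adjacency determines the
map on the arcs.
\<close>

lemma digraph_isoI_arcs_image:
  assumes "pair_wf_digraph H" and bij: "bij_betw f (pverts H) (pverts G)"
    and arcs: "\<And>u v. u \<in> pverts H \<Longrightarrow> v \<in> pverts H \<Longrightarrow> (f u, f v) \<in> parcs G \<longleftrightarrow> (u, v) \<in> parcs H"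
    and "pair_wf_digraph G"
  shows "digraph_iso (with_proj G) (with_proj H)"
proof -
  interpret H: pair_wf_digraph H by fact
  interpret G: pair_wf_digraph G by fact
  define hom where "hom = \<lparr>iso_verts = f, iso_arcs = map_prod f f, iso_head = snd, iso_tail = fst\<rparr>"
  have inj: "inj_on f (pverts H)" and im: "f ` pverts H = pverts G"
    using bij by (auto simp: bij_betw_def)
  have "inj_on (map_prod f f) (parcs H)"
    by (rule inj_on_subset[OF map_prod_inj_on[OF inj inj]]) (auto simp: H.wellformed')
  then have "H.digraph_isomorphism hom"
    unfolding H.digraph_isomorphism_def
    using inj H.wf_digraph_axioms by (auto simp: hom_def)
  moreover have "map_prod f f ` parcs H = parcs G"
  proof (intro equalityI subsetI)
    fix e assume "e \<in> map_prod f f ` parcs H"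
    then show "e \<in> parcs G" using arcs by (auto simp: H.wellformed')
  next
    fix e assume e: "e \<in> parcs G"
    then have "fst e \<in> f ` pverts H" "snd e \<in> f ` pverts H"
      unfolding im by (auto intro: G.arc_fst_in_verts G.arc_snd_in_verts)
    then obtain u v where uv: "u \<in> pverts H" "v \<in> pverts H" "e = (f u, f v)"
      by (metis imageE prod.collapse)
    then have "(u, v) \<in> parcs H" using arcs e by simp
    then show "e \<in> map_prod f f ` parcs H" using uv(3) by force
  qed
  then have "with_proj G = app_iso hom (with_proj H)"
    using im by (simp add: with_proj_def app_iso_def hom_def)
  ultimately have "digraph_iso (with_proj H) (with_proj G)"
    unfolding digraph_iso_def by blast
  then show ?thesis by (rule digraph_iso_swap[OF H.wf_digraph_axioms])
qed

context undirected_tree_graph begin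

lemma finite_tree_dists:
  "finite {tree_dist G u v |u v. u \<in> pverts G \<and> v \<in> pverts G}" (is "finite ?D")
proof -
  have "?D = (\<lambda>(u, v). tree_dist G u v) ` (pverts G \<times> pverts G)"
    by force
  then show ?thesis using pair_finite_verts by simp
qed

lemma tree_dist_le_diameter:
  "u \<in> pverts G \<Longrightarrow> v \<in> pverts G \<Longrightarrow> tree_dist G u v \<le> tree_diameter G"
  unfolding tree_diameter_def by (rule Max_ge[OF finite_tree_dists]) blast

lemma diameter_apath_exists:
  obtains u p v where "apath u p v" "length p = tree_diameter G"
proof -
  have "{tree_dist G u v |u v. u \<in> pverts G \<and> v \<in> pverts G} \<noteq> {}"
    using pverts_nonempty by blast
  then have "tree_diameter G \<in> {tree_dist G u v |u v. u \<in> pverts G \<and> v \<in> pverts G}"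
    unfolding tree_diameter_def by (rule Max_in[OF finite_tree_dists])
  then obtain u v where uv: "u \<in> pverts G" "v \<in> pverts G" "tree_dist G u v = tree_diameter G"
    by auto
  then obtain p where "apath u p v" using apath_exists by blast
  then show ?thesis using that tree_dist_eq_length uv(3) by metis
qed

text \<open>
Paths as vertex lists, because positions on a path are the vertices of the target graph, and because
reversing the list then is the reflection of the path.
\<close>

definition path_list :: "'a list \<Rightarrow> bool" where
  "path_list xs \<longleftrightarrow> distinct xs \<and> set xs \<subseteq> pverts G \<and> (\<forall>k. Suc k < length xs \<longrightarrow> (xs ! k, xs ! Suc k) \<in> parcs G)"

lemma path_list_apath:
  assumes "apath u p v"
  shows "path_list (pawalk_verts u p)"
  using assms
proof (induction p arbitrary: u)
  case Nil
  then show ?case by (auto simp: path_list_def apath_Nil_iff)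
next
  case (Cons e p)
  then have *: "e \<in> parcs G" "fst e = u" "path_list (pawalk_verts (snd e) p)" "u \<notin> set (pawalk_verts (snd e) p)"
    by (auto simp: apath_Cons_iff)
  have "pawalk_verts (snd e) p ! 0 = snd e"
    using Cons.prems by (cases p) (auto simp: apath_Cons_iff)
  then have "((u # pawalk_verts (snd e) p) ! k, (u # pawalk_verts (snd e) p) ! Suc k) \<in> parcs G"
    if "Suc k < length (u # pawalk_verts (snd e) p)" for k
    using that * by (cases k) (auto simp: path_list_def)
  then show ?case using * arc_fst_in_verts by (auto simp: path_list_def)
qed

lemma path_list_rev: "path_list xs \<Longrightarrow> path_list (rev xs)"
  unfolding path_list_def
proof (elim conjE, intro conjI allI impI)
  fix k assume arcs: "\<forall>k. Suc k < length xs \<longrightarrow> (xs ! k, xs ! Suc k) \<in> parcs G"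
    and k: "Suc k < length (rev xs)"
  have "(xs ! (length xs - Suc (Suc k)), xs ! Suc (length xs - Suc (Suc k))) \<in> parcs G"
    using arcs k by auto
  moreover have "Suc (length xs - Suc (Suc k)) = length xs - Suc k" using k by auto
  ultimately show "(rev xs ! k, rev xs ! Suc k) \<in> parcs G"
    using k arcs_symmetric by (simp add: rev_nth)
qed auto

lemma path_list_segment:
  assumes "path_list xs" "i + n < length xs"
  shows "\<exists>p. apath (xs ! i) p (xs ! (i + n)) \<and> length p = n \<and>
    set (pawalk_verts (xs ! i) p) \<subseteq> set (drop i xs)"
  using assms(2)
proof (induction n arbitrary: i)
  case 0
  then show ?case using assms(1)
    by (intro exI[of _ "[]"]) (auto simp: path_list_def apath_Nil_iff Cons_nth_drop_Suc[symmetric])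
next
  case (Suc n)
  then obtain p where p: "apath (xs ! Suc i) p (xs ! (Suc i + n))" "length p = n"
      "set (pawalk_verts (xs ! Suc i) p) \<subseteq> set (drop (Suc i) xs)"
    using Suc.IH[of "Suc i"] by auto
  have drop: "drop i xs = xs ! i # drop (Suc i) xs"
    using Suc.prems by (simp add: Cons_nth_drop_Suc)
  have "distinct (drop i xs)" using assms(1) by (simp add: path_list_def)
  then have "xs ! i \<notin> set (pawalk_verts (xs ! Suc i) p)" using p(3) by (auto simp: drop)
  moreover have "(xs ! i, xs ! Suc i) \<in> parcs G" using assms(1) Suc.prems by (auto simp: path_list_def)
  ultimately show ?case using p
    by (intro exI[of _ "(xs ! i, xs ! Suc i) # p"]) (auto simp: apath_Cons_iff drop)
qed

lemma path_list_arc_consecutive: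
  assumes xs: "path_list xs" and "i < j" "j < length xs" and arc: "(xs ! i, xs ! j) \<in> parcs G"
  shows "j = Suc i"
proof -
  obtain p where "apath (xs ! i) p (xs ! j)" "length p = j - i"
    using path_list_segment[OF xs, of i "j - i"] assms(2,3) by auto
  moreover have "apath (xs ! i) [(xs ! i, xs ! j)] (xs ! j)"
    using arc no_loops'[OF arc] by (auto simp: apath_simps wellformed')
  ultimately show ?thesis using apath_unique assms(2) by fastforce
qed

text \<open>
The detour through \<open>w\<close> and the segment of the path would be two different paths between the same ends.
\<close>

lemma path_list_unique_attachment:
  assumes xs: "path_list xs" and w: "w \<notin> set xs" and ij: "i < j" "j < length xs"
    and arcs: "(w, xs ! i) \<in> parcs G" "(w, xs ! j) \<in> parcs G"
  shows False
proof -
  obtain p where p: "apath (xs ! i) p (xs ! j)" "set (pawalk_verts (xs ! i) p) \<subseteq> set (drop i xs)"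
    using path_list_segment[OF xs, of i "j - i"] ij by auto
  have "xs ! i \<noteq> xs ! j" using xs ij by (auto simp: path_list_def nth_eq_iff_index_eq)
  then have "apath (xs ! i) [(xs ! i, w), (w, xs ! j)] (xs ! j)"
    using arcs arcs_symmetric no_loops' by (auto simp: apath_simps wellformed')
  then have "p = [(xs ! i, w), (w, xs ! j)]" using p(1) by (rule apath_unique[rotated])
  then have "w \<in> set xs" using p(2) set_drop_subset by fastforce
  then show False using w by simp
qed

text \<open>
Otherwise prolonging the path by \<open>w\<close> would exceed the diameter.
\<close>

lemma diametral_path_end_not_attached:
  assumes xs: "path_list xs" and len: "length xs = Suc (tree_diameter G)" and w: "w \<notin> set xs"
  shows "(w, xs ! 0) \<notin> parcs G"
proof
  assume arc: "(w, xs ! 0) \<in> parcs G"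
  obtain p where p: "apath (xs ! 0) p (xs ! tree_diameter G)" "length p = tree_diameter G"
      "set (pawalk_verts (xs ! 0) p) \<subseteq> set xs"
    using path_list_segment[OF xs, of 0 "tree_diameter G"] len by auto
  have "apath w ((w, xs ! 0) # p) (xs ! tree_diameter G)"
    using arc p(1,3) w by (auto simp: apath_Cons_iff)
  then have "tree_dist G w (xs ! tree_diameter G) = Suc (tree_diameter G)"
    using tree_dist_eq_length p(2) by fastforce
  moreover have "xs ! tree_diameter G \<in> pverts G"
    using xs len by (auto simp: path_list_def)
  ultimately show False
    using tree_dist_le_diameter[of w "xs ! tree_diameter G"] arc by (auto simp: wellformed')
qed

text \<open>
Uniqueness of paths excludes all arcs other than those of the path and the one that attaches \<open>w\<close>.
\<close>

lemma iso_P_tree: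
  assumes xs: "path_list xs" and len: "length xs = Suc d" and w: "w \<notin> set xs"
    and verts: "pverts G = insert w (set xs)" and i: "i \<le> d" "(w, xs ! i) \<in> parcs G"
  shows "digraph_iso (with_proj G) (with_proj (P_tree (d + 2) d i))"
proof (rule digraph_isoI_arcs_image)
  interpret P: pair_graph "P_tree (d + 2) d i" using i(1) by (intro pair_graph_P_tree) auto
  show "pair_wf_digraph (P_tree (d + 2) d i)" "pair_wf_digraph G" by unfold_locales
  have dist: "distinct (xs @ [w])" using xs w by (auto simp: path_list_def)
  have "bij_betw ((!) (xs @ [w])) {..<length (xs @ [w])} (set (xs @ [w]))"
    using dist by (intro bij_betw_nth) auto
  then show "bij_betw ((!) (xs @ [w])) (pverts (P_tree (d + 2) d i)) (pverts G)"
    by (simp add: len verts lessThan_atLeast0)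
  have path_arc: "(xs ! a, xs ! b) \<in> parcs G \<longleftrightarrow> b = Suc a \<or> a = Suc b" if "a \<le> d" "b \<le> d" for a b
  proof
    assume arc: "(xs ! a, xs ! b) \<in> parcs G"
    consider "a < b" | "b < a" | "a = b" by linarith
    then show "b = Suc a \<or> a = Suc b"
      using path_list_arc_consecutive[OF xs, of a b] path_list_arc_consecutive[OF xs, of b a]
        arc arcs_symmetric[OF arc] no_loops'[OF arc] that len by cases auto
  next
    assume "b = Suc a \<or> a = Suc b"
    then show "(xs ! a, xs ! b) \<in> parcs G"
      using xs len that arcs_symmetric by (auto simp: path_list_def)
  qed
  have w_arc: "(w, xs ! a) \<in> parcs G \<longleftrightarrow> a = i" if "a \<le> d" for a
    using path_list_unique_attachment[OF xs w, of a i] path_list_unique_attachment[OF xs w, of i a]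
      that i len by (metis le_imp_less_Suc nat_neq_iff)
  have w_arc': "(xs ! a, w) \<in> parcs G \<longleftrightarrow> a = i" if "a \<le> d" for a
    using w_arc[OF that] arcs_symmetric by blast
  have loop: "(w, w) \<notin> parcs G" using no_loops' by blast
  show "((xs @ [w]) ! u, (xs @ [w]) ! v) \<in> parcs G \<longleftrightarrow> (u, v) \<in> parcs (P_tree (d + 2) d i)"
    if "u \<in> pverts (P_tree (d + 2) d i)" "v \<in> pverts (P_tree (d + 2) d i)" for u v
  proof -
    have "u \<le> d \<or> u = Suc d" "v \<le> d \<or> v = Suc d" using that by auto
    then show ?thesis
      using i(1) by (elim disjE) (auto simp: nth_append len path_arc w_arc w_arc' loop P_tree_arc_iff)
  qed
qed

text \<open>
A longest path misses exactly one vertex \<open>w\<close>. Connectedness attaches \<open>w\<close> to the path, maximality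
forbids both ends, and reading the path from the other end moves the attachment to its first half.
\<close>

lemma iso_P_tree_if_card_eq_diameter_plus_2:
  assumes card: "card (pverts G) = tree_diameter G + 2"
  shows "\<exists>i\<in>{1..tree_diameter G div 2}.
    digraph_iso (with_proj G) (with_proj (P_tree (tree_diameter G + 2) (tree_diameter G) i))"
proof -
  define d where "d = tree_diameter G"
  obtain u p v where p: "apath u p v" "length p = d"
    using diameter_apath_exists unfolding d_def by blast
  define xs where "xs = pawalk_verts u p"
  have xs: "path_list xs" unfolding xs_def by (rule path_list_apath[OF p(1)])
  have len: "length xs = Suc d" using p(2) length_awalk_verts by (simp add: xs_def)
  have "card (set xs) = Suc d" using xs len by (simp add: path_list_def distinct_card)
  then have "card (pverts G - set xs) = 1"
    using xs card by (subst card_Diff_subset) (auto simp: path_list_def d_def)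
  then obtain w where "pverts G - set xs = {w}" by (auto simp: card_1_singleton_iff)
  then have w: "w \<notin> set xs" and verts: "pverts G = insert w (set xs)"
    using xs by (auto simp: path_list_def)
  obtain q where q: "apath w q (xs ! 0)"
    using apath_exists[of w "xs ! 0"] verts len by auto
  moreover have "xs ! 0 \<in> set xs" using len by auto
  ultimately obtain y where y: "(w, y) \<in> parcs G"
    using w by (cases q) (auto simp: apath_simps)
  then have "y \<in> set xs" using no_loops'[OF y] wellformed'(2)[OF y] verts by auto
  then obtain i where i: "i \<le> d" "(w, xs ! i) \<in> parcs G"
    using y len by (auto simp: in_set_conv_nth less_Suc_eq_le)
  have rev: "path_list (rev xs)" "length (rev xs) = Suc d" "w \<notin> set (rev xs)" "pverts G = insert w (set (rev xs))"
    using path_list_rev[OF xs] len w verts by auto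
  have rev_i: "(w, rev xs ! (d - i)) \<in> parcs G"
    using i len by (simp add: rev_nth)
  have "i \<noteq> 0"
    using diametral_path_end_not_attached[OF xs] len w i(2) by (metis d_def)
  have "d - i \<noteq> 0"
    using diametral_path_end_not_attached[OF rev(1)] rev(2,3) rev_i by (metis d_def)
  show ?thesis
  proof (cases "i \<le> d div 2")
    case True
    then show ?thesis
      using iso_P_tree[OF xs len w verts i] \<open>i \<noteq> 0\<close> unfolding d_def[symmetric]
      by (intro bexI[of _ i]) auto
  next
    case False
    then show ?thesis
      using iso_P_tree[OF rev _ rev_i] \<open>d - i \<noteq> 0\<close> unfolding d_def[symmetric]
      by (intro bexI[of _ "d - i"]) auto
  qed
qed

end

section \<open>Moving the leaf\<close>

text \<open>
Moving \<open>i\<close> one step to the right brings the \<open>d - i\<close> points on its right nearer by 1 and moves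
the other \<open>i + 1\<close> points farther by 1; the former are the majority as long as \<open>i\<close> is in the
first half.
\<close>

lemma sum_abs_diff_decreasing:
  fixes i d :: nat
  assumes "2 * Suc i \<le> d"
  shows "(\<Sum>k<Suc d. \<bar>real (Suc i) - real k\<bar>) < (\<Sum>k<Suc d. \<bar>real i - real k\<bar>)"
proof -
  have "(\<Sum>k<Suc d. \<bar>real i - real k\<bar>) - (\<Sum>k<Suc d. \<bar>real (Suc i) - real k\<bar>)
      = (\<Sum>k<Suc d. 1 - 2 * (if k \<le> i then 1 else 0))"
    unfolding sum_subtractf[symmetric] by (intro sum.cong) auto
  also have "\<dots> = real (Suc d) - 2 * (\<Sum>k<Suc d. if k \<le> i then 1 else 0)"
    unfolding sum_subtractf sum_distrib_left by simp
  also have "(\<Sum>k<Suc d. if k \<le> i then 1 else (0::real)) = (\<Sum>k | k \<in> {..<Suc d} \<and> k \<le> i. 1)"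
    by (rule sum.inter_filter[symmetric]) simp
  also have "{k. k \<in> {..<Suc d} \<and> k \<le> i} = {..i}"
    using assms by auto
  finally show ?thesis using assms by simp
qed

text \<open>
Only the distances of the single leaf depend on \<open>i\<close>.
\<close>

lemma sum_P_dist:
  assumes "i \<le> d"
  shows "(\<Sum>u<d + 2. \<Sum>v<d + 2. real (P_dist d i u v))
    = (\<Sum>u<Suc d. \<Sum>v<Suc d. \<bar>real u - real v\<bar>) + 2 * (\<Sum>k<Suc d. \<bar>real i - real k\<bar> + 1)"
proof -
  have split: "(\<Sum>u<d + 2. f u) = (\<Sum>u<Suc d. f u) + f (Suc d)" for f :: "nat \<Rightarrow> real"
    by (simp add: numeral_2_eq_2)
  have path: "real (P_dist d i u v) = \<bar>real u - real v\<bar>" if "u < Suc d" "v < Suc d" for u v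
    using that by (auto simp: P_dist_def of_nat_diff abs_real_def)
  have leaf: "real (P_dist d i u (Suc d)) = \<bar>real i - real u\<bar> + 1"
      "real (P_dist d i (Suc d) u) = \<bar>real i - real u\<bar> + 1" if "u < Suc d" for u
    using that by (auto simp: P_dist_def of_nat_diff abs_real_def)
  have "(\<Sum>u<d + 2. \<Sum>v<d + 2. real (P_dist d i u v))
      = (\<Sum>u<Suc d. (\<Sum>v<Suc d. real (P_dist d i u v)) + real (P_dist d i u (Suc d)))
        + (\<Sum>v<Suc d. real (P_dist d i (Suc d) v)) + real (P_dist d i (Suc d) (Suc d))"
    unfolding split by (simp only: add.assoc)
  also have "(\<Sum>u<Suc d. (\<Sum>v<Suc d. real (P_dist d i u v)) + real (P_dist d i u (Suc d)))
      = (\<Sum>u<Suc d. (\<Sum>v<Suc d. \<bar>real u - real v\<bar>) + (\<bar>real i - real u\<bar> + 1))"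
    using path leaf by (intro sum.cong arg_cong2[where f = "(+)"]) auto
  also have "(\<Sum>v<Suc d. real (P_dist d i (Suc d) v)) = (\<Sum>k<Suc d. \<bar>real i - real k\<bar> + 1)"
    using leaf by (intro sum.cong) auto
  also have "real (P_dist d i (Suc d) (Suc d)) = 0" by (simp add: P_dist_def)
  finally show ?thesis by (simp only: sum.distrib) simp
qed

lemma H2_norm_P_tree:
  assumes "i \<le> d"
  shows "H2_norm (P_tree (d + 2) d i)
    = sqrt (((\<Sum>u<Suc d. \<Sum>v<Suc d. \<bar>real u - real v\<bar>)
        + 2 * (\<Sum>k<Suc d. \<bar>real i - real k\<bar> + 1)) / (4 * (d + 2)))"
proof -
  have "(\<Sum>u\<in>{0..<d + 2}. \<Sum>v\<in>{0..<d + 2}. real (tree_dist (P_tree (d + 2) d i) u v))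
      = (\<Sum>u<d + 2. \<Sum>v<d + 2. real (P_dist d i u v))"
    using assms by (intro sum.cong) (auto simp: tree_dist_P_tree)
  then show ?thesis
    using H2_norm_tree[OF undirected_tree_P_tree[of d "d + 2" i]] assms
    by (simp only: P_tree_verts card_atLeastLessThan sum_P_dist diff_zero)
qed

lemma H2_norm_P_tree_decreasing:
  assumes "2 * Suc i \<le> d"
  shows "H2_norm (P_tree (d + 2) d (Suc i)) < H2_norm (P_tree (d + 2) d i)"
proof -
  have "(\<Sum>k<Suc d. \<bar>real (Suc i) - real k\<bar> + 1) < (\<Sum>k<Suc d. \<bar>real i - real k\<bar> + 1)"
    unfolding sum.distrib using sum_abs_diff_decreasing[OF assms] by (rule add_strict_right_mono)
  then have "(s + 2 * (\<Sum>k<Suc d. \<bar>real (Suc i) - real k\<bar> + 1)) / (4 * (d + 2))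
      < (s + 2 * (\<Sum>k<Suc d. \<bar>real i - real k\<bar> + 1)) / (4 * (d + 2))" for s
    by (intro divide_strict_right_mono) auto
  moreover have "Suc i \<le> d" "i \<le> d" using assms by auto
  ultimately show ?thesis by (simp only: H2_norm_P_tree real_sqrt_less_iff)
qed

section \<open>The ordering\<close>

theorem theorem3:
  fixes N :: nat
  assumes "N \<ge> 4"
  shows "(\<forall>T :: 'a pair_pre_digraph. T \<in> trees N (N - 2) \<longrightarrow>
            (\<exists>i \<in> {1..(N - 2) div 2}. digraph_iso (with_proj T) (with_proj (P_tree N (N - 2) i)))) \<and>
         (\<forall>i \<in> {1..(N - 2) div 2}. P_tree N (N - 2) i \<in> trees N (N - 2)) \<and>
         (\<forall>i \<in> {1..<(N - 2) div 2}.
            H2_norm (P_tree N (N - 2) (Suc i)) < H2_norm (P_tree N (N - 2) i))"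
proof -
  define d where "d = N - 2"
  have N: "N = d + 2" and "2 \<le> d" using assms by (auto simp: d_def)
  have "\<exists>i\<in>{1..d div 2}. digraph_iso (with_proj T) (with_proj (P_tree (d + 2) d i))"
    if "T \<in> trees (d + 2) d" for T :: "'a pair_pre_digraph"
  proof -
    have T: "undirected_tree T" "card (pverts T) = d + 2" "tree_diameter T = d"
      using that by (auto simp: trees_def)
    interpret undirected_tree_graph T
      using T(1) by (simp add: undirected_tree_graph_def undirected_tree_graph_axioms_def undirected_tree_def)
    show ?thesis using iso_P_tree_if_card_eq_diameter_plus_2 T(2,3) by simp
  qed
  moreover have "P_tree (d + 2) d i \<in> trees (d + 2) d" if "i \<in> {1..d div 2}" for i
    using that \<open>2 \<le> d\<close> by (intro P_tree_in_trees) auto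
  moreover have "H2_norm (P_tree (d + 2) d (Suc i)) < H2_norm (P_tree (d + 2) d i)"
    if "i \<in> {1..<d div 2}" for i
    using that by (intro H2_norm_P_tree_decreasing) auto
  ultimately show ?thesis unfolding N by simp
qed

end
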